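(* Let $G=(V,E)$ be a complete graph with metric costs $c$. Suppose that the unique optimal solution to $\mathrm{2ECM\text{-}IP}$ on $(G,c)$ is (the incidence vector of) a Hamiltonian cycle $T$. Then: (1) The integral optimal solutions and optimal values coincide between 2ECM and TSP: $T$ is the unique optimal solution of both $\mathrm{2ECM\text{-}IP}$ and $\mathrm{TSP\text{-}IP}$, and $\mathrm{OPT}_{\mathrm{2ECM\text{-}IP}}=\mathrm{OPT}_{\mathrm{TSP\text{-}IP}}=c(T)$. (2) Any $\alpha$-approximation algorithm for 2ECM that outputs a Hamiltonian cycle yields an $\alpha$-approximation for TSP; that is, for every $\alpha$, any output Hamiltonian cycle $H$ with $c(H)\le \alpha\cdot \mathrm{OPT}_{\mathrm{2ECM\text{-}IP}}$ satisfies $c(H)\le \alpha\cdot \mathrm{OPT}_{\mathrm{TSP\text{-}IP}}$. (3) The integrality gap of $\mathrm{TSP\text{-}LP}$ on this instance equals that of $\mathrm{2ECM\text{-}LP}$: \[\mathrm{OPT}_{\mathrm{TSP\text{-}LP}}=\mathrm{OPT}_{\mathrm{2ECM\text{-}LP}}\quad\text{and}\quad \frac{c(T)}{\mathrm{OPT}_{\mathrm{TSP\text{-}LP}}}=\frac{c(T)}{\mathrm{OPT}_{\mathrm{2ECM\text{-}LP}}}.\]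
   Context: Metric costs: $c$ assigns to each edge $ij$ a nonnegative symmetric cost $c_{ij}=c_{ji}\ge 0$ with $c_{ij}\le c_{ik}+c_{kj}$ for all $i,j,k\in V$. For $S\subset V$, $\delta(S)$ is the set of edges with exactly one endpoint in $S$, $\delta(v)=\delta(\{v\})$, and $x(F)=\sum_{e\in F}x_e$. For an edge set $T$, $c(T)=\sum_{e\in T}c_e$. The four problems all minimize $\sum_{e\in E}c_ex_e$: - $\mathrm{TSP\text{-}IP}$: over incidence vectors of Hamiltonian cycles on $V$. - $\mathrm{TSP\text{-}LP}$: subject to $x(\delta(v))=2$ for all $v\in V$; $x(\delta(S))\ge 2$ for all $\emptyset\ne S\subsetneq V$; $0\le x_e\le 1$ for all $e\in E$. - $\mathrm{2ECM\text{-}IP}$ (2-edge-connected spanning multisubgraph problem): subject to $x(\delta(S))\ge 2$ for all $\emptyset\neq S\subsetneq V$; $x_e\ge 0$; $x_e\in\mathbb{Z}$ for all $e\in E$ ($x_e$ is the multiplicity of $e$). - $\mathrm{2ECM\text{-}LP}$: the constraints of $\mathrm{2ECM\text{-}IP}$ without integrality, together with $x(\delta(v))=2$ for all $v\in V$. $\mathrm{OPT}_X$ denotes the optimal objective value of problem $X$ on the given instance. *)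

theory Defs
  imports Complex_Main "HOL-Library.Indicator_Function"
begin

definition complete_edges :: "'a set \<Rightarrow> 'a set set" where
  "complete_edges V = {e. e \<subseteq> V \<and> card e = 2}"

text \<open>Costs are functions of the unordered edge, so that the symmetry of the costs is built in.
  Loops carry no cost, so the triangle inequality is only meaningful (and only imposed) for three
  distinct vertices.\<close>

definition metric_costs :: "'a set \<Rightarrow> ('a set \<Rightarrow> real) \<Rightarrow> bool" where
  "metric_costs V c \<longleftrightarrow>
     (\<forall>e\<in>complete_edges V. 0 \<le> c e) \<and>
     (\<forall>i\<in>V. \<forall>j\<in>V. \<forall>k\<in>V. i \<noteq> j \<and> i \<noteq> k \<and> k \<noteq> j \<longrightarrow> c {i, j} \<le> c {i, k} + c {k, j})"

definition cut :: "'a set \<Rightarrow> 'a set \<Rightarrow> 'a set set" where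
  "cut V S = {e \<in> complete_edges V. card (e \<inter> S) = 1}"

text \<open>A Hamiltonian cycle is identified with its edge set; it visits at least three vertices.\<close>

definition hamiltonian_cycle :: "'a set \<Rightarrow> 'a set set \<Rightarrow> bool" where
  "hamiltonian_cycle V T \<longleftrightarrow>
     (\<exists>vs. distinct vs \<and> set vs = V \<and> length vs \<ge> 3 \<and>
        T = {{vs ! i, vs ! (Suc i mod length vs)} | i. i < length vs})"

text \<open>Vectors indexed by the edges are functions vanishing off the edge set, so that equality of
  vectors is equality of functions. The incidence vector of an edge set \<open>T\<close> is \<open>indicator T\<close>.\<close>

definition edge_vectors :: "'a set \<Rightarrow> ('a set \<Rightarrow> real) set" where
  "edge_vectors V = {x. \<forall>e. e \<notin> complete_edges V \<longrightarrow> x e = 0}"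

definition TSP_IP :: "'a set \<Rightarrow> ('a set \<Rightarrow> real) set" where
  "TSP_IP V = {indicator T | T. hamiltonian_cycle V T}"

definition TSP_LP :: "'a set \<Rightarrow> ('a set \<Rightarrow> real) set" where
  "TSP_LP V = {x \<in> edge_vectors V.
     (\<forall>v\<in>V. sum x (cut V {v}) = 2) \<and>
     (\<forall>S. S \<noteq> {} \<and> S \<subset> V \<longrightarrow> sum x (cut V S) \<ge> 2) \<and>
     (\<forall>e\<in>complete_edges V. 0 \<le> x e \<and> x e \<le> 1)}"

definition TwoECM_IP :: "'a set \<Rightarrow> ('a set \<Rightarrow> real) set" where
  "TwoECM_IP V = {x \<in> edge_vectors V.
     (\<forall>S. S \<noteq> {} \<and> S \<subset> V \<longrightarrow> sum x (cut V S) \<ge> 2) \<and>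
     (\<forall>e\<in>complete_edges V. x e \<ge> 0) \<and>
     (\<forall>e\<in>complete_edges V. x e \<in> \<int>)}"

definition TwoECM_LP :: "'a set \<Rightarrow> ('a set \<Rightarrow> real) set" where
  "TwoECM_LP V = {x \<in> edge_vectors V.
     (\<forall>v\<in>V. sum x (cut V {v}) = 2) \<and>
     (\<forall>S. S \<noteq> {} \<and> S \<subset> V \<longrightarrow> sum x (cut V S) \<ge> 2) \<and>
     (\<forall>e\<in>complete_edges V. x e \<ge> 0)}"

definition objective :: "'a set \<Rightarrow> ('a set \<Rightarrow> real) \<Rightarrow> ('a set \<Rightarrow> real) \<Rightarrow> real" where
  "objective V c x = (\<Sum>e\<in>complete_edges V. c e * x e)"

text \<open>In the following, \<open>P\<close> is one of the four maps above, from a vertex set to a feasible region.\<close>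

definition optimal_solutions ::
  "('a set \<Rightarrow> ('a set \<Rightarrow> real) set) \<Rightarrow> 'a set \<Rightarrow> ('a set \<Rightarrow> real) \<Rightarrow> ('a set \<Rightarrow> real) set" where
  "optimal_solutions P V c = {x. is_arg_min (objective V c) (\<lambda>y. y \<in> P V) x}"

definition OPT :: "('a set \<Rightarrow> ('a set \<Rightarrow> real) set) \<Rightarrow> 'a set \<Rightarrow> ('a set \<Rightarrow> real) \<Rightarrow> real" where
  "OPT P V c = (INF x\<in>P V. objective V c x)"

definition integrality_gap ::
  "('a set \<Rightarrow> ('a set \<Rightarrow> real) set) \<Rightarrow> ('a set \<Rightarrow> ('a set \<Rightarrow> real) set) \<Rightarrow>
   'a set \<Rightarrow> ('a set \<Rightarrow> real) \<Rightarrow> real" where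
  "integrality_gap IP LP V c = OPT IP V c / OPT LP V c"

end

theory Submission
  imports Defs
begin

text \<open>A Hamiltonian cycle crosses every cut at least twice, so \<open>TSP_IP\<close> is contained in
  \<open>TwoECM_IP\<close>, and a unique optimum of the larger problem that lies in the smaller one is its unique
  optimum as well. For the relaxations, the degree constraints at \<open>u\<close> and \<open>v\<close> turn the cut
  constraint of \<open>{u, v}\<close> into \<open>4 - 2 x\<^sub>u\<^sub>v \<ge> 2\<close>, so that the bounds \<open>x\<^sub>e \<le> 1\<close> are redundant and
  the two feasible regions agree.\<close>

lemma finite_complete_edges [simp]: "finite V \<Longrightarrow> finite (complete_edges V)"
  by (rule finite_subset[of _ "Pow V"]) (auto simp: complete_edges_def)

lemma finite_cut [simp]: "finite V \<Longrightarrow> finite (cut V S)"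
  by (simp add: cut_def)

lemma cut_singleton: "cut V {v} = {e \<in> complete_edges V. v \<in> e}"
proof -
  have "card (e \<inter> {v}) = 1 \<longleftrightarrow> v \<in> e" for e
    by (cases "v \<in> e") auto
  then show ?thesis
    by (simp add: cut_def)
qed

lemma cut_doubleton:
  assumes "u \<noteq> v"
  shows "cut V {u, v} = {e \<in> complete_edges V. (u \<in> e) \<noteq> (v \<in> e)}"
proof -
  have "card (e \<inter> {u, v}) = 1 \<longleftrightarrow> (u \<in> e) \<noteq> (v \<in> e)" for e
    using assms by (cases "u \<in> e"; cases "v \<in> e") auto
  then show ?thesis
    by (simp add: cut_def)
qed

text \<open>The cut of \<open>{u, v}\<close> is the symmetric difference of the stars of
  \<open>u\<close> and \<open>v\<close>. Their only common edge is \<open>{u, v}\<close>, which the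
  two star sums count twice.\<close>

lemma sum_cut_doubleton:
  fixes x :: "'a set \<Rightarrow> 'b::ring_1"
  assumes "finite V" "u \<in> V" "v \<in> V" "u \<noteq> v"
  shows "sum x (cut V {u, v}) = sum x (cut V {u}) + sum x (cut V {v}) - 2 * x {u, v}"
proof -
  let ?A = "cut V {u}" and ?B = "cut V {v}"
  have AB: "?A \<inter> ?B = {{u, v}}"
  proof
    show "?A \<inter> ?B \<subseteq> {{u, v}}"
      using \<open>u \<noteq> v\<close> by (auto simp: cut_singleton complete_edges_def card_2_iff)
    show "{{u, v}} \<subseteq> ?A \<inter> ?B"
      using assms by (auto simp: cut_singleton complete_edges_def)
  qed
  have "cut V {u, v} = (?A - ?B) \<union> (?B - ?A)"
    unfolding cut_doubleton[OF \<open>u \<noteq> v\<close>] cut_singleton by auto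
  then have "sum x (cut V {u, v}) = sum x (?A - ?B) + sum x (?B - ?A)"
    using \<open>finite V\<close> by (auto intro!: sum.union_disjoint)
  moreover have "sum x ?A = x {u, v} + sum x (?A - ?B)"
    using sum.Int_Diff[of ?A x ?B] \<open>finite V\<close> AB by simp
  moreover have "sum x ?B = x {u, v} + sum x (?B - ?A)"
    using sum.Int_Diff[of ?B x ?A] \<open>finite V\<close> AB by (simp add: Int_commute)
  ultimately show ?thesis
    by (simp add: mult_2)
qed

lemma TSP_LP_eq_TwoECM_LP:
  assumes "finite V" "card V \<ge> 3"
  shows "TSP_LP V = TwoECM_LP V"
proof
  show "TSP_LP V \<subseteq> TwoECM_LP V"
    by (auto simp: TSP_LP_def TwoECM_LP_def)
  show "TwoECM_LP V \<subseteq> TSP_LP V"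
  proof
    fix x assume x: "x \<in> TwoECM_LP V"
    have "x e \<le> 1" if "e \<in> complete_edges V" for e
    proof -
      from that obtain u v where e: "e = {u, v}" "u \<noteq> v" "u \<in> V" "v \<in> V"
        by (auto simp: complete_edges_def card_2_iff)
      \<comment> \<open>Cut constraints are imposed only on proper subsets, so this is where a third
        vertex is used.\<close>
      have "card {u, v} < card V"
        using e assms by simp
      then have "{u, v} \<subset> V"
        using e by blast
      then have "2 \<le> sum x (cut V {u, v})"
        using x by (simp add: TwoECM_LP_def)
      moreover have "sum x (cut V {u}) = 2" "sum x (cut V {v}) = 2"
        using x e by (simp_all add: TwoECM_LP_def)
      ultimately show ?thesis
        using sum_cut_doubleton[of V u v x] assms(1) e by simp
    qed
    then show "x \<in> TSP_LP V"
      using x by (simp add: TwoECM_LP_def TSP_LP_def)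
  qed
qed

text \<open>If \<open>P\<close> were preserved by every cyclic successor step, walking on from
  \<open>a\<close> would carry it to all indices, \<open>b\<close> included. Applied to membership
  in a vertex set and to its negation, this gives an edge of the cycle leaving the set and one
  entering it.\<close>

lemma cyclic_exit:
  fixes n :: nat
  assumes "a < n" "P a" "b < n" "\<not> P b"
  shows "\<exists>i<n. P i \<and> \<not> P (Suc i mod n)"
proof (rule ccontr)
  assume "\<not> ?thesis"
  then have step: "P (Suc i mod n)" if "i < n" "P i" for i
    using that by blast
  have reach: "P ((a + k) mod n)" for k
  proof (induction k)
    case (Suc k)
    show ?case
      using step[OF _ Suc] \<open>a < n\<close> by (simp add: mod_Suc_eq)
  qed (use assms in simp)
  \<comment> \<open>Adding \<open>n\<close> before subtracting \<open>a\<close> keeps the natural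
    subtraction from truncating when \<open>b < a\<close>.\<close>
  have "(a + (b + n - a)) mod n = b"
    using assms by simp
  then show False
    using reach[of "b + n - a"] \<open>\<not> P b\<close> by simp
qed

lemma hamiltonian_cycle_subset:
  assumes "hamiltonian_cycle V T"
  shows "T \<subseteq> complete_edges V"
proof
  fix e assume "e \<in> T"
  with assms obtain vs i where vs: "distinct vs" "set vs = V" "length vs \<ge> 3" "i < length vs"
    and e: "e = {vs ! i, vs ! (Suc i mod length vs)}"
    unfolding hamiltonian_cycle_def by blast
  have "Suc i mod length vs < length vs"
    by (rule mod_less_divisor) (use vs in linarith)
  \<comment> \<open>No edge of the cycle degenerates to a loop, even at the wrap-around
    index.\<close>
  moreover have "i \<noteq> Suc i mod length vs"
    using vs by (simp add: mod_Suc)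
  ultimately show "e \<in> complete_edges V"
    using vs by (auto simp: complete_edges_def e nth_eq_iff_index_eq)
qed

lemma hamiltonian_cycle_card:
  assumes "hamiltonian_cycle V T"
  shows "card V \<ge> 3"
  using assms distinct_card unfolding hamiltonian_cycle_def by metis

text \<open>A closed tour that leaves \<open>S\<close> must also return to it; with at least three
  vertices the leaving and the returning edge differ.\<close>

lemma card_hamiltonian_cycle_cut:
  assumes "finite V" "hamiltonian_cycle V T" "S \<noteq> {}" "S \<subset> V"
  shows "card (T \<inter> cut V S) \<ge> 2"
proof -
  from assms obtain vs where vs: "distinct vs" "set vs = V" "length vs \<ge> 3"
    and T: "T = {{vs ! i, vs ! (Suc i mod length vs)} | i. i < length vs}"
    unfolding hamiltonian_cycle_def by blast
  define n where "n = length vs"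
  define f where "f i = {vs ! i, vs ! (Suc i mod n)}" for i
  have n: "n \<ge> 3"
    using vs n_def by simp
  obtain a b where ab: "a < n" "vs ! a \<in> S" "b < n" "vs ! b \<notin> S"
    using assms vs unfolding n_def by (metis in_set_conv_nth psubset_imp_ex_mem ex_in_conv psubsetD DiffE)
  obtain i where i: "i < n" "vs ! i \<in> S" "vs ! (Suc i mod n) \<notin> S"
    using cyclic_exit[of a n "\<lambda>i. vs ! i \<in> S" b] ab by blast
  obtain j where j: "j < n" "vs ! j \<notin> S" "vs ! (Suc j mod n) \<in> S"
    using cyclic_exit[of b n "\<lambda>i. vs ! i \<notin> S" a] ab by blast
  have "f i \<in> T" "f j \<in> T"
    using i j by (auto simp: T f_def n_def)
  moreover from this have "f i \<in> cut V S" "f j \<in> cut V S"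
    using i j hamiltonian_cycle_subset[OF assms(2)] by (auto simp: cut_def f_def)
  moreover have "f i \<noteq> f j"
  proof
    \<comment> \<open>Since \<open>vs ! i\<close> lies in \<open>S\<close> and \<open>vs ! j\<close>
      does not, equal edges must have their endpoints matched crosswise. Then \<open>i\<close> and
      \<open>j\<close> are cyclic successors of each other, so two steps lead from \<open>i\<close>
      back to \<open>i\<close>, which is impossible for \<open>n \<ge> 3\<close>.\<close>
    assume "f i = f j"
    then have "vs ! i = vs ! (Suc j mod n)" "vs ! j = vs ! (Suc i mod n)"
      using i j by (auto simp: f_def doubleton_eq_iff)
    moreover have "Suc i mod n < n" "Suc j mod n < n"
      using n by simp_all
    ultimately have "i = Suc j mod n" "j = Suc i mod n"
      using i(1) j(1) nth_eq_iff_index_eq[OF vs(1)] by (simp_all add: n_def)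
    moreover have "Suc (Suc i mod n) mod n \<noteq> i"
      using n i(1) by (auto simp: mod_Suc)
    ultimately show False
      by simp
  qed
  ultimately have "{f i, f j} \<subseteq> T \<inter> cut V S" "card {f i, f j} = 2"
    by auto
  then show ?thesis
    using card_mono[of "T \<inter> cut V S" "{f i, f j}"] assms(1) by simp
qed

lemma TSP_IP_subset_TwoECM_IP:
  assumes "finite V"
  shows "TSP_IP V \<subseteq> TwoECM_IP V"
proof
  fix x assume "x \<in> TSP_IP V"
  then obtain T where T: "hamiltonian_cycle V T" and x: "x = indicator T"
    by (auto simp: TSP_IP_def)
  have "sum x (cut V S) \<ge> 2" if "S \<noteq> {}" "S \<subset> V" for S
  proof -
    have "sum x (cut V S) = card (T \<inter> cut V S)"
      using assms by (simp add: x indicator_def sum.If_cases Int_commute)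
    then show ?thesis
      using card_hamiltonian_cycle_cut[OF assms T that] by linarith
  qed
  then show "x \<in> TwoECM_IP V"
    using hamiltonian_cycle_subset[OF T]
    by (auto simp: TwoECM_IP_def edge_vectors_def x indicator_def)
qed

lemma objective_indicator:
  assumes "finite V" "T \<subseteq> complete_edges V"
  shows "objective V c (indicator T) = sum c T"
  using assms by (simp add: objective_def indicator_def sum.If_cases Int_absorb1 if_distrib cong: if_cong)

text \<open>An optimal solution attains the infimum in \<open>OPT\<close>, which is therefore a
  genuine minimum.\<close>

lemma OPT_eq_objective:
  assumes "x \<in> optimal_solutions P V c"
  shows "OPT P V c = objective V c x"
  unfolding OPT_def
  by (rule cInf_eq_minimum)
    (use assms in \<open>auto simp: optimal_solutions_def is_arg_min_linorder\<close>)

text \<open>An optimum over \<open>P V\<close> costs no more than \<open>x\<close> and is feasible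
  in \<open>Q V\<close>, so it is optimal there too and must be \<open>x\<close>.\<close>

lemma unique_optimal_solution_subset:
  assumes "P V \<subseteq> Q V" "x \<in> P V" "optimal_solutions Q V c = {x}"
  shows "optimal_solutions P V c = {x}"
proof -
  have x: "x \<in> Q V" "\<And>y. y \<in> Q V \<Longrightarrow> objective V c x \<le> objective V c y"
    using assms(3) by (auto simp: optimal_solutions_def is_arg_min_linorder)
  have "y = x" if "y \<in> optimal_solutions P V c" for y
  proof -
    have "y \<in> Q V" "objective V c y \<le> objective V c x"
      using that assms by (auto simp: optimal_solutions_def is_arg_min_linorder)
    then have "y \<in> optimal_solutions Q V c"
      using x(2) by (force simp: optimal_solutions_def is_arg_min_linorder)
    then show "y = x"
      using assms(3) by simp
  qed
  moreover have "x \<in> optimal_solutions P V c"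
    using assms x by (auto simp: optimal_solutions_def is_arg_min_linorder)
  ultimately show ?thesis
    by blast
qed

theorem proposition2p1:
  fixes V :: "'a set" and c :: "'a set \<Rightarrow> real" and T :: "'a set set"
  assumes "finite V"
    and "metric_costs V c"
    and "hamiltonian_cycle V T"
    and "optimal_solutions TwoECM_IP V c = {indicator T}"
  shows "(optimal_solutions TwoECM_IP V c = {indicator T} \<and>
          optimal_solutions TSP_IP V c = {indicator T} \<and>
          OPT TwoECM_IP V c = OPT TSP_IP V c \<and>
          OPT TSP_IP V c = sum c T) \<and>
         (\<forall>\<alpha>::real. \<forall>H. hamiltonian_cycle V H \<and> sum c H \<le> \<alpha> * OPT TwoECM_IP V c \<longrightarrow>
            sum c H \<le> \<alpha> * OPT TSP_IP V c) \<and>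
         (integrality_gap TSP_IP TSP_LP V c = integrality_gap TwoECM_IP TwoECM_LP V c \<and>
          OPT TSP_LP V c = OPT TwoECM_LP V c \<and>
          sum c T / OPT TSP_LP V c = sum c T / OPT TwoECM_LP V c)"
proof -
  have T: "indicator T \<in> TSP_IP V"
    using assms(3) by (auto simp: TSP_IP_def)
  have TSP: "optimal_solutions TSP_IP V c = {indicator T}"
    using unique_optimal_solution_subset[of TSP_IP V TwoECM_IP, OF TSP_IP_subset_TwoECM_IP T] assms by simp
  have "objective V c (indicator T) = sum c T"
    using objective_indicator assms(1) hamiltonian_cycle_subset[OF assms(3)] .
  then have OPT_IP: "OPT TwoECM_IP V c = sum c T" "OPT TSP_IP V c = sum c T"
    using assms(4) TSP by (simp_all add: OPT_eq_objective[where x = "indicator T"])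
  \<comment> \<open>Both infima range over the same feasible region, so they agree whether or not
    they are attained.\<close>
  have OPT_LP: "OPT TSP_LP V c = OPT TwoECM_LP V c"
    using TSP_LP_eq_TwoECM_LP[OF assms(1) hamiltonian_cycle_card[OF assms(3)]]
    by (simp add: OPT_def)
  show ?thesis
    using assms(4) TSP OPT_IP OPT_LP by (simp add: integrality_gap_def)
qed

end
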